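(* For each integer $n\ge 0$, $$\overline{S_o}(4n+3)\equiv \overline{S_e}(4n+3)\equiv 0\pmod 8,$$ $$\overline{S_o}(8n+7)\equiv \overline{S_e}(8n+7)\equiv 0\pmod{64}.$$
   Context: An overpartition of a nonnegative integer $n$ is a partition of $n$ in which the first occurrence of each distinct part may be overlined (or not). $\overline{S_o}(n)$ (respectively $\overline{S_e}(n)$) denotes the sum of all the odd (respectively even) parts appearing in all the overpartitions of $n$, where parts are counted with multiplicity and an overlined part counts with its numerical size. *)

theory Defs
  imports "HOL-Library.Multiset" "HOL-Number_Theory.Cong"
begin

text \<open>
  A partition of \<open>n\<close> is the multiset of its (positive) parts. Since only the first occurrence of
  each distinct part may be overlined, an overpartition is determined by its underlying
  partition \<open>P\<close> together with the set \<open>L\<close> of those part sizes whose first occurrence is overlined.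
\<close>

definition partitions :: "nat \<Rightarrow> nat multiset set" where
  "partitions n = {P. (\<forall>k\<in>#P. 0 < k) \<and> sum_mset P = n}"

definition overpartitions :: "nat \<Rightarrow> (nat multiset \<times> nat set) set" where
  "overpartitions n = {(P, L). P \<in> partitions n \<and> L \<subseteq> set_mset P}"

text \<open>
  \<open>P\<close> contains all parts with multiplicity, the overlined ones included.
\<close>

definition odd_part_sum :: "nat \<Rightarrow> nat" where
  "odd_part_sum n = (\<Sum>(P, L)\<in>overpartitions n. \<Sum>k\<in>#filter_mset odd P. k)"

definition even_part_sum :: "nat \<Rightarrow> nat" where
  "even_part_sum n = (\<Sum>(P, L)\<in>overpartitions n. \<Sum>k\<in>#filter_mset even P. k)"

text \<open>The outer sums above range over finite sets.\<close>

lemma finite_partitions: "finite (partitions n)"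
proof (rule finite_subset)
  show "partitions n \<subseteq> mset ` {xs. set xs \<subseteq> {..n} \<and> length xs \<le> n}"
  proof
    fix P assume P: "P \<in> partitions n"
    obtain xs where xs: "P = mset xs" by (metis ex_mset)
    have pos: "\<forall>k\<in>set xs. 1 \<le> k" and sum: "sum_list xs = n"
      using P by (auto simp: partitions_def xs sum_mset_sum_list Suc_le_eq)
    have "length xs \<le> sum_list xs"
      using pos by (induction xs) auto
    moreover have "set xs \<subseteq> {..n}"
      using sum member_le_sum_list by fastforce
    ultimately show "P \<in> mset ` {xs. set xs \<subseteq> {..n} \<and> length xs \<le> n}"
      using sum xs by auto
  qed
  show "finite (mset ` {xs. set xs \<subseteq> {..n} \<and> length xs \<le> n})"
    by (intro finite_imageI finite_lists_length_le) simp
qed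

lemma finite_overpartitions: "finite (overpartitions n)"
proof -
  have "overpartitions n = Sigma (partitions n) (\<lambda>P. Pow (set_mset P))"
    by (auto simp: overpartitions_def)
  then show ?thesis
    by (simp add: finite_partitions)
qed

end

theory Submission
  imports Defs "HOL-Computational_Algebra.Computational_Algebra"
begin

text \<open>
  Write \<open>P(q)\<close> for the generating function of overpartitions and \<open>\<phi>(q)\<close> for the sum of \<open>q\<^sup>j\<^sup>2\<close> over all
  integers \<open>j\<close>. Everything rests on Gauss's identity \<open>P(q) \<phi>(-q) = 1\<close>. Split
  \<open>\<phi>(q) = E + 2 h\<close> into even and odd squares; here \<open>E = \<phi>(q\<^sup>4)\<close> has exponents divisible by 4, while
  \<open>h\<close>, the sum of \<open>q\<^sup>j\<^sup>2\<close> over odd positive \<open>j\<close>, has exponents congruent to 1 modulo 8. The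
  substitution \<open>(a, b) \<mapsto> (a + b, a - b)\<close> in sums of two squares gives
  \<open>E\<^sup>2 - 4 h\<^sup>2 = \<phi>(-q\<^sup>2)\<^sup>2\<close> and \<open>E\<^sup>2 + 4 h\<^sup>2 = \<phi>(q\<^sup>2)\<^sup>2\<close>. Applied repeatedly, these push the denominator of
  \<open>P = 1 / (E - 2 h)\<close> into powers of \<open>q\<^sup>8\<close>:
  \<open>P = (E + 2 h) (E\<^sup>2 + 4 h\<^sup>2) E\<^sup>4 v\<close>, where all exponents of \<open>v\<close> are divisible by 8.

  A part of size \<open>k\<close> contributes \<open>2 k q\<^sup>k / (1 - q\<^sup>2\<^sup>k)\<close> to the logarithmic derivative \<open>q P' / P\<close>. The odd
  \<open>k\<close> contribute exactly the odd powers of \<open>q\<close>, so the generating function \<open>S\<close> of the sums of odd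
  parts is \<open>P\<close> times the odd part of \<open>q P' / P\<close>. As \<open>P = 1 / (E - 2 h)\<close>, that odd part is
  \<open>(2 E \<cdot> q h' - 2 h \<cdot> q E') / (E\<^sup>2 - 4 h\<^sup>2)\<close>, and clearing denominators as before yields
  \<open>S = (E + 2 h) (2 E \<cdot> q h' - 2 h \<cdot> q E') (E\<^sup>2 + 4 h\<^sup>2)\<^sup>2 E\<^sup>8 v\<^sup>2\<close>.

  Both products are now expanded in powers of \<open>h\<close> and \<open>q h'\<close>; modulo 4 the exponents of a term equal
  its degree in these two. The terms with exponents congruent to 3 modulo 4 are \<open>8 E\<^sup>4 h\<^sup>3 v\<close> for \<open>P\<close>,
  and \<open>16 E\<^sup>1\<^sup>2 h\<^sup>2 (q h') v\<^sup>2 - 16 E\<^sup>1\<^sup>1 h\<^sup>3 (q E') v\<^sup>2\<close> for \<open>S\<close>. This gives the congruences modulo 8.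
  For exponents congruent to 7 modulo 8 only the part of \<open>E\<^sup>4\<close> or \<open>E\<^sup>1\<^sup>2\<close> with exponents congruent to 4
  modulo 8 matters, and its coefficients are divisible by 8 and 4 respectively, because
  \<open>E = x + 2 y\<close> with exponents of \<open>x\<close> and \<open>y\<close> congruent to 0 and 4; moreover \<open>q E'\<close> is divisible by 4.
  This gives 64. The even parts follow, since all the parts together sum to \<open>n\<close> times the number
  of overpartitions of \<open>n\<close>.
\<close>

unbundle fps_syntax

section \<open>Overpartitions with restricted parts\<close>

text \<open>
  Restricting the parts to a set \<open>S\<close> allows sizes to be added one at a time, both to reach all
  positive parts and to single out the multiplicity of one size.
\<close>

definition overpartitions_in :: "nat set \<Rightarrow> nat \<Rightarrow> (nat multiset \<times> nat set) set" where
  "overpartitions_in S n = {(P, L). set_mset P \<subseteq> S \<and> sum_mset P = n \<and> L \<subseteq> set_mset P}"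

lemma overpartitions_eq_overpartitions_in: "overpartitions n = overpartitions_in {0<..} n"
  by (auto simp: overpartitions_def partitions_def overpartitions_in_def)

lemma finite_overpartitions_in:
  assumes "S \<subseteq> {0<..}"
  shows "finite (overpartitions_in S n)"
  by (rule finite_subset[OF _ finite_overpartitions[of n]])
     (use assms in \<open>auto simp: overpartitions_in_def overpartitions_eq_overpartitions_in\<close>)

definition overpartition_fps :: "nat set \<Rightarrow> int fps" where
  "overpartition_fps S = Abs_fps (\<lambda>n. int (card (overpartitions_in S n)))"

lemma filter_neq_plus_replicate: "filter_mset (\<lambda>i. i \<noteq> k) P + replicate_mset (count P k) k = P"
  by (intro multiset_eqI) auto

lemma sum_mset_split_off:
  "sum_mset P = sum_mset (filter_mset (\<lambda>i. i \<noteq> k) P) + count P k * k" for P :: "nat multiset"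
  using arg_cong[OF filter_neq_plus_replicate[of k P], of sum_mset] by simp

text \<open>
  Removing the \<open>j\<close> copies of \<open>k\<close> leaves an overpartition with parts in \<open>S\<close>. The factor 2 is the
  choice of overlining the first copy, which exists only if \<open>j > 0\<close>.
\<close>

lemma card_overpartitions_in_fixed_count:
  assumes "k \<notin> S"
  shows "card {x \<in> overpartitions_in (insert k S) n. count (fst x) k = j} =
           (if j * k \<le> n then (if j = 0 then 1 else 2) * card (overpartitions_in S (n - j * k)) else 0)"
proof (cases "j * k \<le> n")
  case True
  let ?R = "replicate_mset j k"
  let ?A = "overpartitions_in S (n - j * k) \<times> Pow (set_mset ?R)"
  let ?B = "{x \<in> overpartitions_in (insert k S) n. count (fst x) k = j}"
  let ?f = "\<lambda>((P, L), M). (P + ?R, L \<union> M)"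
  let ?g = "\<lambda>(P, L). ((filter_mset (\<lambda>i. i \<noteq> k) P, L - {k}), L \<inter> {k})"
  have mem_A: "x \<in> ?A \<longleftrightarrow> (\<exists>P L M. x = ((P, L), M) \<and> set_mset P \<subseteq> S \<and> sum_mset P = n - j * k \<and>
      L \<subseteq> set_mset P \<and> M \<subseteq> set_mset ?R)" for x
    unfolding overpartitions_in_def by (cases x) auto
  have mem_B: "x \<in> ?B \<longleftrightarrow> (\<exists>P L. x = (P, L) \<and> set_mset P \<subseteq> insert k S \<and> sum_mset P = n \<and>
      L \<subseteq> set_mset P \<and> count P k = j)" for x
    unfolding overpartitions_in_def by (cases x) auto
  have "bij_betw ?f ?A ?B"
  proof (rule bij_betwI)
    show "?f \<in> ?A \<rightarrow> ?B"
    proof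
      fix x assume "x \<in> ?A"
      then obtain P L M where x: "x = ((P, L), M)" "set_mset P \<subseteq> S" "sum_mset P = n - j * k"
        "L \<subseteq> set_mset P" "M \<subseteq> set_mset ?R"
        unfolding mem_A by blast
      have "k \<notin># P" using x(2) assms by blast
      then have "count (P + ?R) k = j" by (simp add: count_eq_zero_iff)
      moreover have "sum_mset (P + ?R) = n" using x(3) True by simp
      moreover have "set_mset (P + ?R) \<subseteq> insert k S" using x(2) by (auto split: if_splits)
      moreover have "L \<union> M \<subseteq> set_mset (P + ?R)" using x(4,5) by (simp only: set_mset_union) blast
      ultimately show "?f x \<in> ?B" unfolding mem_B x prod.case by blast
    qed
    show "?g \<in> ?B \<rightarrow> ?A"
    proof
      fix x assume "x \<in> ?B"
      then obtain P L where x: "x = (P, L)" "set_mset P \<subseteq> insert k S" "sum_mset P = n"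
        "L \<subseteq> set_mset P" "count P k = j"
        unfolding mem_B by blast
      have "sum_mset (filter_mset (\<lambda>i. i \<noteq> k) P) = n - j * k"
        using sum_mset_split_off[of P k] x(3,5) by simp
      moreover have "set_mset (filter_mset (\<lambda>i. i \<noteq> k) P) \<subseteq> S"
        unfolding set_mset_filter using x(2) by blast
      moreover have "L - {k} \<subseteq> set_mset (filter_mset (\<lambda>i. i \<noteq> k) P)"
        unfolding set_mset_filter using x(4) by blast
      moreover have "L \<inter> {k} \<subseteq> set_mset ?R"
      proof (cases "k \<in> L")
        case True
        then have "k \<in># P" using x(4) by blast
        then have "j \<noteq> 0" unfolding x(5)[symmetric] count_eq_zero_iff by blast
        then show ?thesis by simp
      next
        case False
        then show ?thesis by simp
      qed
      ultimately show "?g x \<in> ?A" unfolding mem_A x(1) prod.case by blast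
    qed
    show "?g (?f x) = x" if mem: "x \<in> ?A" for x
    proof -
      obtain P L M where x: "x = ((P, L), M)" "set_mset P \<subseteq> S" "L \<subseteq> set_mset P" "M \<subseteq> set_mset ?R"
        using mem unfolding mem_A by blast
      have "k \<notin># P" using x(2) assms by blast
      then have filt: "filter_mset (\<lambda>i. i \<noteq> k) (P + ?R) = P"
        by (intro multiset_eqI) (auto simp: count_eq_zero_iff)
      have "k \<notin> L" using \<open>k \<notin># P\<close> x(3) by blast
      have "M \<subseteq> {k}" using x(4) by (auto split: if_splits)
      have L: "(L \<union> M) - {k} = L" using \<open>k \<notin> L\<close> \<open>M \<subseteq> {k}\<close> by blast
      have M: "(L \<union> M) \<inter> {k} = M" using \<open>k \<notin> L\<close> \<open>M \<subseteq> {k}\<close> by blast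
      show ?thesis unfolding x(1) prod.case filt L M ..
    qed
    show "?f (?g x) = x" if mem: "x \<in> ?B" for x
    proof -
      obtain P L where x: "x = (P, L)" "count P k = j"
        using mem unfolding mem_B by blast
      have "L - {k} \<union> L \<inter> {k} = L" by blast
      then show ?thesis
        unfolding x(1) prod.case x(2)[symmetric] filter_neq_plus_replicate by simp
    qed
  qed
  then have "card ?B = card ?A"
    by (rule bij_betw_same_card[symmetric])
  then show ?thesis
    using True by (simp add: card_cartesian_product card_Pow)
next
  case False
  have "j * k \<le> n" if "(P, L) \<in> overpartitions_in (insert k S) n" "count P k = j" for P L
    using sum_mset_split_off[of P k] that by (simp add: overpartitions_in_def)
  then have "{x \<in> overpartitions_in (insert k S) n. count (fst x) k = j} = {}"
    using False by auto
  then have "card {x \<in> overpartitions_in (insert k S) n. count (fst x) k = j} = 0"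
    by (simp only: card.empty)
  then show ?thesis using False by simp
qed

text \<open>
  Grouping by the multiplicity of \<open>k\<close> turns the weighted count into a Cauchy product. The weight 1
  gives the Euler factor of \<open>k\<close>, and the identity weight counts how often \<open>k\<close> occurs as a part.
\<close>

lemma count_weighted_overpartition_fps:
  fixes w :: "nat \<Rightarrow> int"
  assumes "k > 0" "k \<notin> S" "S \<subseteq> {0<..}"
  shows "Abs_fps (\<lambda>n. \<Sum>(P, L)\<in>overpartitions_in (insert k S) n. w (count P k)) =
         overpartition_fps S * (Abs_fps (\<lambda>j. (if j = 0 then 1 else 2) * w j) oo fps_X ^ k)"
proof (rule fps_ext)
  fix n
  let ?A = "overpartitions_in (insert k S) n"
  have fin: "finite ?A" using assms by (intro finite_overpartitions_in) auto
  have le: "count (fst x) k \<le> n" if mem: "x \<in> ?A" for x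
  proof -
    have "count (fst x) k * k \<le> n"
      using that sum_mset_split_off[of "fst x" k] by (auto simp: overpartitions_in_def)
    moreover have "count (fst x) k * 1 \<le> count (fst x) k * k"
      using assms(1) by (intro mult_le_mono) auto
    ultimately show ?thesis by linarith
  qed
  have "(\<Sum>(P, L)\<in>?A. w (count P k)) = (\<Sum>x\<in>?A. w (count (fst x) k))"
    by (simp add: case_prod_unfold)
  also have "\<dots> = (\<Sum>j\<le>n. \<Sum>x\<in>{x \<in> ?A. count (fst x) k = j}. w (count (fst x) k))"
    using le by (intro sum.group[symmetric] fin) auto
  also have "\<dots> = (\<Sum>j\<le>n. w j * int (card {x \<in> ?A. count (fst x) k = j}))"
    by (intro sum.cong) auto
  also have "\<dots> = (\<Sum>j\<in>{j. j \<le> n \<and> j * k \<le> n}. ((if j = 0 then 1 else 2) * w j) * int (card (overpartitions_in S (n - j * k))))"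
    unfolding card_overpartitions_in_fixed_count[OF assms(2)]
    by (intro sum.mono_neutral_cong_right) auto
  also have "\<dots> = (\<Sum>i\<in>{i. i \<le> n \<and> k dvd i}. ((if i div k = 0 then 1 else 2) * w (i div k)) * int (card (overpartitions_in S (n - i))))"
  proof (rule sum.reindex_bij_witness[where j = "\<lambda>j. j * k" and i = "\<lambda>i. i div k"])
    fix i assume "i \<in> {i. i \<le> n \<and> k dvd i}"
    moreover have "i div k \<le> i" by simp
    ultimately show "i div k * k = i" "i div k \<in> {j. j \<le> n \<and> j * k \<le> n}"
      by (simp_all del: div_le_dividend)
  qed (use assms(1) in simp_all)
  also have "\<dots> = (\<Sum>i=0..n. (Abs_fps (\<lambda>j. (if j = 0 then 1 else 2) * w j) oo fps_X ^ k) $ i * overpartition_fps S $ (n - i))"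
    using assms(1)
    by (intro sum.mono_neutral_cong_left) (auto simp: fps_nth_compose_X_power overpartition_fps_def)
  finally show "Abs_fps (\<lambda>n. \<Sum>(P, L)\<in>overpartitions_in (insert k S) n. w (count P k)) $ n =
         (overpartition_fps S * (Abs_fps (\<lambda>j. (if j = 0 then 1 else 2) * w j) oo fps_X ^ k)) $ n"
    by (subst mult.commute) (simp add: fps_mult_nth)
qed

lemma overpartition_fps_insert:
  assumes "k > 0" "k \<notin> S" "S \<subseteq> {0<..}"
  shows "overpartition_fps (insert k S) =
           overpartition_fps S * (Abs_fps (\<lambda>j. if j = 0 then 1 else 2) oo fps_X ^ k)"
  using count_weighted_overpartition_fps[OF assms, of "\<lambda>_. 1"]
  by (simp add: overpartition_fps_def case_prod_unfold)

lemma one_minus_mult_nth: "((1 - fps_X) * f) $ n = f $ n - (if n = 0 then 0 else f $ (n - 1))"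
  for f :: "int fps"
  by (simp add: left_diff_distrib)

lemma one_plus_mult_nth: "((1 + fps_X) * f) $ n = f $ n + (if n = 0 then 0 else f $ (n - 1))"
  for f :: "int fps"
  by (simp add: distrib_right)

text \<open>
  The Euler factor is \<open>1 + 2 q\<^sup>k + 2 q\<^sup>2\<^sup>k + \<dots> = (1 + q\<^sup>k) / (1 - q\<^sup>k)\<close>.
\<close>

lemma overpartition_fps_insert_mult:
  assumes "k > 0" "k \<notin> S" "S \<subseteq> {0<..}"
  shows "overpartition_fps (insert k S) * (1 - fps_X ^ k) = overpartition_fps S * (1 + fps_X ^ k)"
proof -
  have "(1 - fps_X) * Abs_fps (\<lambda>j. if j = 0 then 1 else 2) = (1 + fps_X :: int fps)"
    by (rule fps_ext) (simp only: one_minus_mult_nth, auto)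
  then have "((1 - fps_X) * Abs_fps (\<lambda>j. if j = 0 then 1 else 2)) oo fps_X ^ k = (1 + fps_X :: int fps) oo fps_X ^ k"
    by simp
  then have "(Abs_fps (\<lambda>j. if j = 0 then 1 else 2) oo fps_X ^ k) * (1 - fps_X ^ k) = (1 + fps_X ^ k :: int fps)"
    using assms(1)
    by (simp add: fps_compose_mult_distrib fps_compose_sub_distrib fps_compose_add_distrib mult.commute)
  then show ?thesis
    unfolding overpartition_fps_insert[OF assms] by (simp only: mult.assoc)
qed

text \<open>
  Without the remaining parts, the occurrences of \<open>k\<close> are counted by \<open>h(q\<^sup>k)\<close> with
  \<open>h(x) = 2 x / (1 - x)\<^sup>2\<close>. Since \<open>h(x)\<close> is the product of \<open>(1 + x) / (1 - x)\<close> and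
  \<open>2 x / (1 - x\<^sup>2) = 2 x + 2 x\<^sup>3 + \<dots>\<close>, the first factor restores the overpartitions with all parts.
\<close>

lemma part_count_fps:
  assumes "k > 0"
  shows "Abs_fps (\<lambda>n. \<Sum>(P, L)\<in>overpartitions n. int (count P k)) =
         overpartition_fps {0<..} * (Abs_fps (\<lambda>j. if odd j then 2 else 0) oo fps_X ^ k)"
proof -
  define g h d :: "int fps" where "g = Abs_fps (\<lambda>j. if j = 0 then 1 else 2)"
    and "h = Abs_fps (\<lambda>j. (if j = 0 then 1 else 2) * int j)"
    and "d = Abs_fps (\<lambda>j. if odd j then 2 else 0)"
  have 1: "(1 - fps_X) * g = 1 + fps_X"
    by (rule fps_ext) (simp only: one_minus_mult_nth, auto simp: g_def)
  have 2: "(1 - fps_X) * h = g - 1"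
    by (rule fps_ext) (simp only: one_minus_mult_nth, auto simp: g_def h_def of_nat_diff algebra_simps)
  have 3: "(1 + fps_X) * d = g - 1"
    by (rule fps_ext) (simp only: one_plus_mult_nth, auto simp: g_def d_def)
  have "(1 - fps_X) * (g * d) = (1 - fps_X) * h"
    by (simp only: 1 2 3 mult.assoc[symmetric])
  moreover have "(1 - fps_X :: int fps) \<noteq> 0"
    by simp
  ultimately have "g * d = h" by simp
  define S where "S = {0<..} - {k}"
  have S: "k \<notin> S" "S \<subseteq> {0<..}" "insert k S = {0<..}"
    using assms by (auto simp: S_def)
  have "Abs_fps (\<lambda>n. \<Sum>(P, L)\<in>overpartitions n. int (count P k)) = overpartition_fps S * (h oo fps_X ^ k)"
    using count_weighted_overpartition_fps[OF assms S(1,2), of int]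
    by (simp add: S(3) h_def overpartitions_eq_overpartitions_in)
  also have "\<dots> = overpartition_fps S * (g oo fps_X ^ k) * (d oo fps_X ^ k)"
    using assms by (simp add: \<open>g * d = h\<close>[symmetric] fps_compose_mult_distrib mult.assoc)
  also have "overpartition_fps S * (g oo fps_X ^ k) = overpartition_fps {0<..}"
    using overpartition_fps_insert[OF assms S(1,2)] by (simp add: S(3) g_def)
  finally show ?thesis by (simp add: d_def)
qed

section \<open>A finite form of Gauss's identity\<close>

text \<open>
  Here \<open>P s\<close> stands for the product of the factors \<open>(1 + x\<^sup>i) / (1 - x\<^sup>i)\<close> with \<open>i \<le> s\<close>. The error terms
  all carry a power \<open>x\<^sup>m\<close> with \<open>m > n\<close>, so for a formal variable \<open>x\<close> the partial theta sum is the
  inverse of \<open>P n\<close> up to order \<open>n\<close>. The identity is of the type that Shanks found for the theorems of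
  Euler and Gauss: in the step from \<open>n\<close> to \<open>n + 1\<close> the change of the right-hand sum telescopes, since
  \<open>(1 - x\<^sup>s) (P s + P (s - 1)) = 2 P (s - 1)\<close> and \<open>(1 + x\<^sup>s) (P s + P (s - 1)) = 2 P s\<close>.
\<close>

lemma finite_Gauss_identity:
  fixes x :: "'a :: idom" and P :: "nat \<Rightarrow> 'a"
  assumes P0: "P 0 = 1"
    and step: "\<And>s. P (Suc s) * (1 - x ^ Suc s) = P s * (1 + x ^ Suc s)"
    and nz: "\<And>n. n > 0 \<Longrightarrow> x ^ n \<noteq> 1"
  shows "(1 + 2 * (\<Sum>s=1..n. (-1) ^ s * x ^ (s\<^sup>2))) * P n =
           1 + (\<Sum>s=1..n. (-1) ^ s * x ^ (s * (n + 1)) * (P s + P (s - 1)))"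
proof (induction n)
  case 0
  show ?case by (simp add: P0)
next
  case (Suc n)
  define F where "F = 1 + 2 * (\<Sum>s=1..n. (-1) ^ s * x ^ (s\<^sup>2))"
  define R where "R = (\<lambda>m n. \<Sum>s=1..m. (-1) ^ s * x ^ (s * (n + 1)) * (P s + P (s - 1)))"
  define N where "N = Suc n"
  define g where "g = (\<lambda>s. (-1) ^ s * x ^ (s * N) * P (s - 1))"
  have step': "P s * (1 - x ^ s) = P (s - 1) * (1 + x ^ s)" if "s > 0" for s
    using step[of "s - 1"] that by simp
  \<comment> \<open>for each \<open>s\<close>, the change of the summand is \<open>2 * (g (s + 1) - g s)\<close>\<close>
  have tele: "(1 - x ^ N) * R m N - (1 + x ^ N) * R m n = 2 * (g (Suc m) - g 1)" for m
  proof (induction m)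
    case 0
    show ?case by (simp add: R_def)
  next
    case (Suc m)
    define s where "s = Suc m"
    have a: "(1 - x ^ s) * (P s + P (s - 1)) = 2 * P (s - 1)"
      using step'[of s] by (simp add: s_def algebra_simps)
    have b: "(1 + x ^ s) * (P s + P (s - 1)) = 2 * P s"
      using step'[of s] by (simp add: s_def algebra_simps)
    have "(1 - x ^ N) * R s N - (1 + x ^ N) * R s n =
        2 * (g s - g 1) + (-1) ^ s * ((1 - x ^ N) * x ^ (s * (N + 1)) - (1 + x ^ N) * x ^ (s * N)) * (P s + P (s - 1))"
      using Suc by (simp add: R_def s_def N_def algebra_simps)
    also have "(-1) ^ s * ((1 - x ^ N) * x ^ (s * (N + 1)) - (1 + x ^ N) * x ^ (s * N)) * (P s + P (s - 1))
        = - ((-1) ^ s * x ^ (s * N) * ((1 - x ^ s) * (P s + P (s - 1)) + x ^ N * ((1 + x ^ s) * (P s + P (s - 1)))))"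
      by (simp add: algebra_simps power_add)
    also have "\<dots> = 2 * (g (Suc s) - g s)"
      unfolding a b by (simp add: g_def algebra_simps power_add)
    finally show ?case by (simp add: s_def)
  qed
  have last: "(1 - x ^ N) * (P N + P (N - 1)) = 2 * P n" "(1 - x ^ N) * P N = (1 + x ^ N) * P n"
    using step'[of N] by (simp_all add: N_def algebra_simps)
  have N1: "N - Suc 0 = n" by (simp add: N_def)
  have sq: "x ^ (N\<^sup>2) = x ^ (N * N)" by (simp add: power2_eq_square)
  \<comment> \<open>the induction step is verified after multiplication by \<open>1 - x ^ N\<close>, which is cancelled at the end\<close>
  have "(1 - x ^ N) * ((F + 2 * ((-1) ^ N * x ^ (N\<^sup>2))) * P N) =
      (F + 2 * ((-1) ^ N * x ^ (N\<^sup>2))) * ((1 - x ^ N) * P N)"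
    by (simp add: algebra_simps)
  also have "\<dots> = (1 + x ^ N) * (F * P n) + 2 * ((-1) ^ N * x ^ (N\<^sup>2)) * (1 + x ^ N) * P n"
    unfolding last by (simp add: algebra_simps)
  also have "F * P n = 1 + R n n"
    using Suc by (simp add: F_def R_def)
  also have "(1 + x ^ N) * (1 + R n n) = (1 - x ^ N) * (1 + R n N) + 2 * x ^ N - 2 * (g N - g 1)"
    using tele[of n] by (simp add: N_def algebra_simps)
  also have "\<dots> + 2 * ((-1) ^ N * x ^ (N\<^sup>2)) * (1 + x ^ N) * P n =
      (1 - x ^ N) * (1 + R n N) + (-1) ^ N * x ^ (N * (N + 1)) * (2 * P n)"
    by (simp add: g_def P0 sq N1 algebra_simps power_add)
  also have "2 * P n = (1 - x ^ N) * (P N + P (N - 1))" using last by simp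
  finally have "(1 - x ^ N) * ((F + 2 * ((-1) ^ N * x ^ (N\<^sup>2))) * P N) = (1 - x ^ N) * (1 + R N N)"
    by (simp add: R_def N_def algebra_simps)
  moreover have "1 - x ^ N \<noteq> 0" using nz[of N] by (simp add: N_def)
  ultimately have "(F + 2 * ((-1) ^ N * x ^ (N\<^sup>2))) * P N = 1 + R N N"
    by (metis mult_cancel_left)
  then show ?case by (simp add: F_def R_def N_def algebra_simps)
qed

section \<open>Series supported on squares\<close>

text \<open>
  The series of \<open>w j \<cdot> q\<^sup>j\<^sup>2\<close>, summed over all integers \<open>j\<close>. Keeping both signs of \<open>j\<close> makes products
  sums over lattice points, where the substitution \<open>(a + b, a - b)\<close> is available.
\<close>

definition square_fps :: "(int \<Rightarrow> int) \<Rightarrow> int fps" where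
  "square_fps w = Abs_fps (\<lambda>n. \<Sum>j | j\<^sup>2 = int n. w j)"

lemma abs_le_square: "\<bar>j\<bar> \<le> j\<^sup>2" for j :: int
  using self_le_power[of "\<bar>j\<bar>" 2] by (cases "j = 0") auto

lemma finite_square_roots: "finite {j :: int. j\<^sup>2 = n}"
proof (rule finite_subset)
  show "{j. j\<^sup>2 = n} \<subseteq> {-n..n}"
  proof
    fix j assume "j \<in> {j. j\<^sup>2 = n}"
    then show "j \<in> {-n..n}" using abs_le_square[of j] by (simp add: abs_le_iff)
  qed
qed simp

lemma square_fps_add: "square_fps v + square_fps w = square_fps (\<lambda>j. v j + w j)"
  by (rule fps_ext) (simp add: square_fps_def sum.distrib)

lemma square_fps_cmult: "fps_const c * square_fps w = square_fps (\<lambda>j. c * w j)"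
  by (rule fps_ext) (simp add: square_fps_def sum_distrib_left)

lemma square_fps_reflect: "square_fps (\<lambda>j. w (- j)) = square_fps w"
  unfolding square_fps_def
  by (intro arg_cong[of _ _ Abs_fps] ext sum.reindex_bij_witness[where i = uminus and j = uminus]) auto

lemma square_fps_symmetric:
  assumes "\<And>j. w (- j) = w j"
  shows "square_fps w = fps_const (w 0) + 2 * square_fps (\<lambda>j. if j > 0 then w j else 0)"
proof -
  let ?p = "\<lambda>j. if j > 0 then w j else 0"
  have const: "square_fps (\<lambda>j. if j = 0 then w 0 else 0) = fps_const (w 0)"
  proof (rule fps_ext)
    fix n
    show "square_fps (\<lambda>j. if j = 0 then w 0 else 0) $ n = fps_const (w 0) $ n"
      by (simp add: square_fps_def finite_square_roots)
  qed
  have "square_fps w = square_fps (\<lambda>j. (if j = 0 then w 0 else 0) + (?p j + ?p (- j)))"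
    using assms by (intro arg_cong[of _ _ square_fps]) (auto simp: fun_eq_iff)
  then have "square_fps w = square_fps (\<lambda>j. if j = 0 then w 0 else 0) +
      (square_fps ?p + square_fps (\<lambda>j. ?p (- j)))"
    unfolding square_fps_add .
  also have "square_fps (\<lambda>j. ?p (- j)) = square_fps ?p"
    by (rule square_fps_reflect)
  finally show ?thesis
    by (simp only: const mult_2)
qed

lemma square_fps_mult_nth:
  "(square_fps v * square_fps w) $ n = (\<Sum>(i, j) | i\<^sup>2 + j\<^sup>2 = int n. v i * w j)"
proof -
  have "(square_fps v * square_fps w) $ n =
      (\<Sum>k=0..n. \<Sum>(i, j)\<in>{i. i\<^sup>2 = int k} \<times> {j. j\<^sup>2 = int (n - k)}. v i * w j)"
    by (simp add: fps_mult_nth square_fps_def sum_product sum.cartesian_product)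
  also have "\<dots> = (\<Sum>(k, i, j)\<in>(SIGMA k:{0..n}. {i. i\<^sup>2 = int k} \<times> {j. j\<^sup>2 = int (n - k)}). v i * w j)"
    by (subst sum.Sigma) (auto simp: finite_square_roots)
  also have "\<dots> = (\<Sum>(i, j) | i\<^sup>2 + j\<^sup>2 = int n. v i * w j)"
  proof (intro sum.reindex_bij_witness[where i = "\<lambda>(i, j). (nat (i\<^sup>2), i, j)" and j = "\<lambda>(k, i, j). (i, j)"])
    fix b :: "int \<times> int"
    assume "b \<in> {(i, j). i\<^sup>2 + j\<^sup>2 = int n}"
    then obtain i j where b: "b = (i, j)" "i\<^sup>2 + j\<^sup>2 = int n" by blast
    obtain p where p: "i\<^sup>2 = int p" using zero_le_imp_eq_int[of "i\<^sup>2"] by auto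
    obtain q where q: "j\<^sup>2 = int q" using zero_le_imp_eq_int[of "j\<^sup>2"] by auto
    have "n = p + q" using b(2) unfolding p q by linarith
    then show "(\<lambda>(i, j). (nat (i\<^sup>2), i, j)) b \<in> (SIGMA k:{0..n}. {i. i\<^sup>2 = int k} \<times> {j. j\<^sup>2 = int (n - k)})"
      by (simp add: b(1) p q)
  qed (auto simp: of_nat_diff)
  finally show ?thesis .
qed

definition theta_even :: "int fps" where
  "theta_even = square_fps (\<lambda>j. of_bool (even j))"

definition theta_odd :: "int fps" where
  "theta_odd = square_fps (\<lambda>j. of_bool (odd j))"

definition odd_squares :: "int fps" where
  "odd_squares = square_fps (\<lambda>j. of_bool (odd j \<and> j > 0))"

lemma theta_odd_eq: "theta_odd = 2 * odd_squares"
proof -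
  have "(\<lambda>j::int. if 0 < j then of_bool (odd j) else 0 :: int) = (\<lambda>j. of_bool (odd j \<and> j > 0))"
    by auto
  then show ?thesis
    unfolding theta_odd_def odd_squares_def
    by (subst square_fps_symmetric) auto
qed

text \<open>
  The even squares are the numbers \<open>4 j\<^sup>2\<close>: this is \<open>E(q) = \<phi>(q\<^sup>4)\<close>.
\<close>

lemma theta_even_dilation: "theta_even = (theta_even + theta_odd) oo fps_X ^ 4"
proof (rule fps_ext)
  fix n
  have "theta_even $ n = (if 4 dvd n then \<Sum>j | j\<^sup>2 = int (n div 4). 1 else 0)"
  proof (cases "4 dvd n")
    case True
    then obtain m where m: "n = 4 * m" by blast
    have "theta_even $ n = (\<Sum>j | j\<^sup>2 = int n \<and> even j. 1)"
      unfolding theta_even_def square_fps_def fps_nth_Abs_fps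
      by (intro sum.mono_neutral_cong_right) (auto simp: finite_square_roots)
    also have "\<dots> = (\<Sum>j | j\<^sup>2 = int m. 1)"
      by (intro sum.reindex_bij_witness[where i = "\<lambda>j. 2 * j" and j = "\<lambda>j. j div 2"])
         (auto simp: m elim!: evenE)
    finally show ?thesis using m by simp
  next
    case False
    have "\<not> (j\<^sup>2 = int n \<and> even j)" for j :: int
    proof
      assume "j\<^sup>2 = int n \<and> even j"
      then have "2 * 2 dvd int n" unfolding power2_eq_square by (metis mult_dvd_mono)
      with False show False by presburger
    qed
    then show ?thesis using False
      by (auto simp: theta_even_def square_fps_def intro!: sum.neutral)
  qed
  also have "theta_even + theta_odd = square_fps (\<lambda>_. 1)"
    unfolding theta_even_def theta_odd_def square_fps_add by (rule arg_cong[of _ _ square_fps]) auto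
  then have "(if 4 dvd n then \<Sum>j | j\<^sup>2 = int (n div 4). 1 else 0) = ((theta_even + theta_odd) oo fps_X ^ 4) $ n"
    by (simp add: fps_nth_compose_X_power square_fps_def)
  finally show "theta_even $ n = ((theta_even + theta_odd) oo fps_X ^ 4) $ n" .
qed

text \<open>
  The left side sums over pairs \<open>(i, j)\<close> of equal parity. These are the pairs \<open>(a + b, a - b)\<close>, with
  \<open>i\<^sup>2 + j\<^sup>2 = 2 (a\<^sup>2 + b\<^sup>2)\<close>, and the sign carried by odd \<open>i\<close> factors as the signs of \<open>a\<close> and \<open>b\<close>. The
  values \<open>s = 1\<close> and \<open>s = -1\<close> are the expansions of \<open>\<phi>(q\<^sup>2)\<^sup>2\<close> and \<open>\<phi>(-q\<^sup>2)\<^sup>2\<close>.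
\<close>

lemma theta_two_squares:
  fixes s :: int
  assumes s: "s * s = 1"
  shows "theta_even\<^sup>2 + fps_const s * theta_odd\<^sup>2 = ((theta_even + fps_const s * theta_odd) oo fps_X ^ 2)\<^sup>2"
proof (rule fps_ext)
  fix n
  define c :: "int \<Rightarrow> int" where "c = (\<lambda>j. if even j then 1 else s)"
  have c: "theta_even + fps_const s * theta_odd = square_fps c"
    unfolding theta_even_def theta_odd_def square_fps_cmult square_fps_add
    by (rule arg_cong[of _ _ square_fps]) (auto simp: c_def)
  have c_mult: "c i * c j = c (i + j)" for i j using s by (auto simp: c_def)
  have "(theta_even\<^sup>2 + fps_const s * theta_odd\<^sup>2) $ n =
      (\<Sum>(i, j) | i\<^sup>2 + j\<^sup>2 = int n. of_bool (even i) * of_bool (even j)) +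
      s * (\<Sum>(i, j) | i\<^sup>2 + j\<^sup>2 = int n. of_bool (odd i) * of_bool (odd j))"
    by (simp add: power2_eq_square theta_even_def theta_odd_def square_fps_mult_nth)
  also have "\<dots> = (\<Sum>(i, j) | i\<^sup>2 + j\<^sup>2 = int n. if even (i + j) then c i else 0)"
    unfolding sum_distrib_left sum.distrib[symmetric] by (intro sum.cong) (auto simp: c_def)
  also have "\<dots> = (if even n then \<Sum>(i, j) | i\<^sup>2 + j\<^sup>2 = int (n div 2). c i * c j else 0)"
  proof (cases "even n")
    case True
    then obtain m where m: "n = 2 * m" by blast
    have ev: "even (i + j)" if "i\<^sup>2 + j\<^sup>2 = int n" for i j :: int
    proof -
      have "even (i\<^sup>2 + j\<^sup>2)" unfolding that using True by simp
      then show ?thesis by simp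
    qed
    have "(\<Sum>(i, j) | i\<^sup>2 + j\<^sup>2 = int n. if even (i + j) then c i else 0) = (\<Sum>(i, j) | i\<^sup>2 + j\<^sup>2 = int n. c i)"
      using ev by (intro sum.cong) auto
    also have "\<dots> = (\<Sum>(i, j) | i\<^sup>2 + j\<^sup>2 = int m. c i * c j)"
    proof (rule sum.reindex_bij_witness[where i = "\<lambda>(a, b). (a + b, a - b)" and j = "\<lambda>(i, j). ((i + j) div 2, (i - j) div 2)"])
      fix x :: "int \<times> int"
      assume "x \<in> {(i, j). i\<^sup>2 + j\<^sup>2 = int n}"
      moreover obtain i j where "x = (i, j)" by fastforce
      ultimately have x: "x = (i, j)" "i\<^sup>2 + j\<^sup>2 = int n" by auto
      define a b where "a = (i + j) div 2" and "b = (i - j) div 2"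
      have "i + j = 2 * a" using ev[OF x(2)] by (simp add: a_def)
      moreover have "i - j = 2 * b" using ev[OF x(2)] by (simp add: b_def)
      ultimately have ij: "i = a + b" "j = a - b" by auto
      have ab: "(i + j) div 2 = a" "(i - j) div 2 = b" by (simp_all add: a_def b_def)
      show "(\<lambda>(a, b). (a + b, a - b)) ((\<lambda>(i, j). ((i + j) div 2, (i - j) div 2)) x) = x"
        unfolding x prod.case ab by (simp add: ij)
      have "a\<^sup>2 + b\<^sup>2 = int m"
        using x(2) unfolding ij m by (simp add: power2_eq_square algebra_simps)
      then show "(\<lambda>(i, j). ((i + j) div 2, (i - j) div 2)) x \<in> {(i, j). i\<^sup>2 + j\<^sup>2 = int m}"
        unfolding x prod.case ab by simp
      show "(case (\<lambda>(i, j). ((i + j) div 2, (i - j) div 2)) x of (i, j) \<Rightarrow> c i * c j) = (case x of (i, j) \<Rightarrow> c i)"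
        unfolding x prod.case ab c_mult using ij(1) by simp
    next
      fix x :: "int \<times> int"
      assume "x \<in> {(i, j). i\<^sup>2 + j\<^sup>2 = int m}"
      moreover obtain a b where "x = (a, b)" by fastforce
      ultimately have x: "x = (a, b)" "a\<^sup>2 + b\<^sup>2 = int m" by auto
      show "(\<lambda>(i, j). ((i + j) div 2, (i - j) div 2)) ((\<lambda>(a, b). (a + b, a - b)) x) = x"
        by (simp add: x)
      show "(\<lambda>(a, b). (a + b, a - b)) x \<in> {(i, j). i\<^sup>2 + j\<^sup>2 = int n}"
      proof -
        have "(a + b)\<^sup>2 + (a - b)\<^sup>2 = 2 * (a\<^sup>2 + b\<^sup>2)" by (simp add: power2_eq_square algebra_simps)
        then show ?thesis using x(2) by (simp add: x(1) m)
      qed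
    qed
    finally show ?thesis using m by simp
  next
    case False
    have "odd (i + j)" if "i\<^sup>2 + j\<^sup>2 = int n" for i j :: int
    proof -
      have "odd (i\<^sup>2 + j\<^sup>2)" unfolding that using False by simp
      then show ?thesis by simp
    qed
    then show ?thesis using False by (auto intro!: sum.neutral)
  qed
  also have "\<dots> = ((square_fps c)\<^sup>2 oo fps_X ^ 2) $ n"
    by (simp add: fps_nth_compose_X_power power2_eq_square[of "square_fps c"] square_fps_mult_nth)
  finally show "(theta_even\<^sup>2 + fps_const s * theta_odd\<^sup>2) $ n = (((theta_even + fps_const s * theta_odd) oo fps_X ^ 2)\<^sup>2) $ n"
    by (simp add: c fps_compose_power)
qed

text \<open>
  The coefficient of \<open>q\<^sup>n\<close> sees only the squares and the parts that are at most \<open>n\<close>, so it can be read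
  off the finite identity at \<open>n\<close>.
\<close>

theorem Gauss_overpartition_identity:
  "overpartition_fps {0<..} * (theta_even - theta_odd) = 1"
proof (rule fps_ext)
  fix n
  define c :: "int \<Rightarrow> int" where "c = (\<lambda>j. if even j then 1 else -1)"
  define F :: "int fps" where "F = 1 + 2 * (\<Sum>s=1..n. (-1) ^ s * fps_X ^ (s\<^sup>2))"
  have "theta_even + fps_const (-1) * theta_odd = square_fps c"
    unfolding theta_even_def theta_odd_def square_fps_cmult square_fps_add
    by (rule arg_cong[of _ _ square_fps]) (auto simp: c_def)
  then have alt: "theta_even - theta_odd = square_fps c"
    by (simp only: fps_const_neg[symmetric] fps_const_1_eq_1) simp
  have F: "square_fps c $ m = F $ m" if "m \<le> n" for m
  proof -
    have "(\<Sum>j | j\<^sup>2 = int m. if 0 < j then c j else 0) = (\<Sum>j | j\<^sup>2 = int m \<and> 0 < j. c j)"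
      by (intro sum.mono_neutral_cong_right) (auto simp: finite_square_roots)
    also have "\<dots> = (\<Sum>s | s \<in> {1..n} \<and> m = s\<^sup>2. (-1) ^ s)"
    proof (rule sum.reindex_bij_witness[where i = int and j = nat])
      fix j assume j: "j \<in> {j. j\<^sup>2 = int m \<and> 0 < j}"
      then have "int ((nat j)\<^sup>2) = int m" by simp
      then have sq: "(nat j)\<^sup>2 = m" by (simp only: of_nat_eq_iff)
      have "nat j \<le> m" by (rule power2_nat_le_imp_le[OF eq_imp_le[OF sq]])
      moreover have "1 \<le> nat j" using j by (simp add: Suc_le_eq)
      ultimately show "nat j \<in> {s \<in> {1..n}. m = s\<^sup>2}"
        unfolding mem_Collect_eq atLeastAtMost_iff using order_trans[OF _ that, of "nat j"] sq[symmetric] by blast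
      show "(- 1) ^ nat j = c j" using j by (auto simp: c_def even_nat_iff)
    qed auto
    also have "\<dots> = (\<Sum>s=1..n. if m = s\<^sup>2 then (-1) ^ s else 0)"
      by (intro sum.mono_neutral_cong_left) auto
    also have "\<dots> = (\<Sum>s=1..n. (-1) ^ s * fps_X ^ (s\<^sup>2) :: int fps) $ m"
    proof -
      have "((-1) ^ s * fps_X ^ (s\<^sup>2) :: int fps) $ m = (if m = s\<^sup>2 then (-1) ^ s else 0)" for s
        by (cases "even s") auto
      then show ?thesis by (simp add: fps_sum_nth)
    qed
    finally have "(\<Sum>j | j\<^sup>2 = int m. if 0 < j then c j else 0) = (\<Sum>s=1..n. (-1) ^ s * fps_X ^ (s\<^sup>2) :: int fps) $ m" .
    then have "square_fps (\<lambda>j. if 0 < j then c j else 0) $ m = (\<Sum>s=1..n. (-1) ^ s * fps_X ^ (s\<^sup>2) :: int fps) $ m"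
      unfolding square_fps_def fps_nth_Abs_fps .
    moreover have "square_fps c = fps_const (c 0) + 2 * square_fps (\<lambda>j. if 0 < j then c j else 0)"
      by (rule square_fps_symmetric) (simp add: c_def)
    moreover have "fps_const (c 0) = 1" by (simp add: c_def)
    ultimately show ?thesis
      unfolding F_def by (simp only: mult_2 fps_add_nth)
  qed
  define P where "P = (\<lambda>s. overpartition_fps {0<..s})"
  have P: "overpartition_fps {0<..} $ m = P n $ m" if "m \<le> n" for m
  proof -
    have "overpartitions_in {0<..} m = overpartitions_in {0<..n} m"
    proof -
      have "k \<le> sum_mset M" if "k \<in># M" for k and M :: "nat multiset"
        using that by (metis sum_mset.remove le_add1)
      then show ?thesis using \<open>m \<le> n\<close> by (fastforce simp: overpartitions_in_def)
    qed
    then show ?thesis by (simp add: P_def overpartition_fps_def)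
  qed
  have "overpartitions_in {} m = (if m = 0 then {({#}, {})} else {})" for m
    by (auto simp: overpartitions_in_def)
  then have P0: "P 0 = 1"
    by (intro fps_ext) (simp add: P_def overpartition_fps_def)
  have step: "P (Suc s) * (1 - fps_X ^ Suc s) = P s * (1 + fps_X ^ Suc s)" for s
  proof -
    have "{0<..Suc s} = insert (Suc s) {0<..s}" by auto
    then show ?thesis unfolding P_def by (subst overpartition_fps_insert_mult[symmetric]) auto
  qed
  \<comment> \<open>needed to cancel \<open>1 - q\<^sup>k\<close> in the finite identity\<close>
  have X_neq: "fps_X ^ k \<noteq> (1 :: int fps)" if "k > 0" for k
  proof
    assume eq: "fps_X ^ k = (1 :: int fps)"
    have "(fps_X ^ k :: int fps) $ k = 1" by simp
    then show False unfolding eq using that by simp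
  qed
  have "(overpartition_fps {0<..} * (theta_even - theta_odd)) $ n = (F * P n) $ n"
    unfolding alt mult.commute[of "overpartition_fps _"] fps_mult_nth
    by (intro sum.cong) (auto simp: F P)
  also have "\<dots> = (1 + (\<Sum>s=1..n. (-1) ^ s * fps_X ^ (s * (n + 1)) * (P s + P (s - 1)))) $ n"
    unfolding F_def by (subst finite_Gauss_identity[of P fps_X n, OF P0 step X_neq]) auto
  also have "\<dots> = (1 :: int fps) $ n"
  proof -
    have "((-1) ^ s * fps_X ^ (s * (n + 1)) * (P s + P (s - 1))) $ n = 0" if "s \<in> {1..n}" for s
    proof -
      have "1 * (n + 1) \<le> s * (n + 1)" using that by (intro mult_le_mono) auto
      then have "n < s * (n + 1)" by (rule order.strict_trans2[rotated]) simp
      then have "(fps_X ^ (s * (n + 1)) * ((-1) ^ s * (P s + P (s - 1)))) $ n = 0"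
        by (simp only: fps_X_power_mult_nth if_True)
      then show ?thesis by (simp only: mult_ac)
    qed
    then show ?thesis by (simp add: fps_sum_nth)
  qed
  finally show "(overpartition_fps {0<..} * (theta_even - theta_odd)) $ n = (1 :: int fps) $ n" .
qed

section \<open>Exponents in a residue class\<close>

definition exponents_cong :: "nat \<Rightarrow> nat \<Rightarrow> 'a :: comm_ring_1 fps \<Rightarrow> bool" where
  "exponents_cong m r f \<longleftrightarrow> (\<forall>n. f $ n \<noteq> 0 \<longrightarrow> [n = r] (mod m))"

lemma exponents_congD: "exponents_cong m r f \<Longrightarrow> \<not> [n = r] (mod m) \<Longrightarrow> f $ n = 0"
  by (auto simp: exponents_cong_def)

lemma exponents_cong_add: "exponents_cong m r f \<Longrightarrow> exponents_cong m r g \<Longrightarrow> exponents_cong m r (f + g)"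
  by (auto simp: exponents_cong_def) (metis add_0)

lemma exponents_cong_diff: "exponents_cong m r f \<Longrightarrow> exponents_cong m r g \<Longrightarrow> exponents_cong m r (f - g)"
  by (auto simp: exponents_cong_def) metis

lemma exponents_cong_mult:
  assumes "exponents_cong m r f" "exponents_cong m s g"
  shows "exponents_cong m (r + s) (f * g)"
  unfolding exponents_cong_def
proof (intro allI impI)
  fix n assume "(f * g) $ n \<noteq> 0"
  then obtain i where i: "i \<le> n" "f $ i * g $ (n - i) \<noteq> 0"
    unfolding fps_mult_nth by (elim sum.not_neutral_contains_not_neutral) auto
  then have "f $ i \<noteq> 0" "g $ (n - i) \<noteq> 0" by auto
  then have "[i + (n - i) = r + s] (mod m)"
    using assms by (intro cong_add) (auto simp: exponents_cong_def)
  then show "[n = r + s] (mod m)" using i(1) by simp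
qed

lemma exponents_cong_const: "exponents_cong m 0 (fps_const c)"
  by (auto simp: exponents_cong_def)

lemma exponents_cong_numeral: "exponents_cong m 0 (numeral c)"
  unfolding numeral_fps_const by (rule exponents_cong_const)

lemma exponents_cong_power: "exponents_cong m 0 f \<Longrightarrow> exponents_cong m 0 (f ^ k)"
proof (induction k)
  case 0
  show ?case using exponents_cong_const[of m 1] by simp
next
  case (Suc k)
  then show ?case using exponents_cong_mult[of m 0 f 0 "f ^ k"] by simp
qed

lemma exponents_cong_modulus: "exponents_cong m r f \<Longrightarrow> k dvd m \<Longrightarrow> exponents_cong k r f"
  unfolding exponents_cong_def by (meson cong_dvd_modulus_nat)

lemma exponents_cong_residue: "exponents_cong m r f \<Longrightarrow> [r = s] (mod m) \<Longrightarrow> exponents_cong m s f"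
  unfolding exponents_cong_def by (meson cong_trans)

lemma exponents_cong_dilate:
  assumes "exponents_cong m r f" "k > 0"
  shows "exponents_cong (k * m) (k * r) (f oo fps_X ^ k)"
  unfolding exponents_cong_def
proof (intro allI impI)
  fix n assume "(f oo fps_X ^ k) $ n \<noteq> 0"
  then have "k dvd n" "f $ (n div k) \<noteq> 0"
    using assms(2) by (auto simp: fps_nth_compose_X_power split: if_splits)
  moreover from this have "[n div k = r] (mod m)" using assms(1) by (simp add: exponents_cong_def)
  ultimately show "[n = k * r] (mod (k * m))"
    using assms(2) by (auto simp: cong_def elim!: dvdE)
qed

lemma q_derivative_nth: "(fps_X * fps_deriv f) $ n = of_nat n * f $ n" for f :: "'a :: comm_ring_1 fps"
  by (cases n) auto

lemma exponents_cong_q_derivative: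
  "exponents_cong m r f \<Longrightarrow> exponents_cong m r (fps_X * fps_deriv f)"
  unfolding exponents_cong_def q_derivative_nth by (metis mult_zero_right)

lemma numeral_mult_fps_nth: "(numeral k * f) $ n = numeral k * f $ n" for f :: "'a :: comm_ring_1 fps"
  by (simp add: numeral_fps_const)

section \<open>Clearing the theta denominators\<close>

lemma odd_square_cong: "odd (j::int) \<Longrightarrow> [j\<^sup>2 = 1] (mod 8)"
proof -
  assume "odd j"
  then obtain k where j: "j = 2 * k + 1" by (elim oddE)
  have "even (k * (k + 1))" by simp
  then obtain l where l: "k * (k + 1) = 2 * l" by (elim evenE)
  have "j\<^sup>2 = 1 + 4 * (k * (k + 1))" unfolding j by (simp add: power2_eq_square algebra_simps)
  then have "j\<^sup>2 = 1 + 8 * l" unfolding l by simp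
  then show ?thesis by (simp add: cong_def)
qed

lemma exponents_cong_odd_squares: "exponents_cong 8 1 odd_squares"
  unfolding exponents_cong_def
proof (intro allI impI)
  fix n assume "odd_squares $ n \<noteq> 0"
  then obtain j :: int where "j\<^sup>2 = int n" "odd j"
    unfolding odd_squares_def square_fps_def fps_nth_Abs_fps
    by (elim sum.not_neutral_contains_not_neutral) (auto split: if_splits)
  then have "[int n = int 1] (mod int 8)" using odd_square_cong[of j] by simp
  then show "[n = 1] (mod 8)" by (simp only: cong_int_iff)
qed

lemma exponents_cong_theta_even: "exponents_cong 4 0 theta_even"
proof -
  have "exponents_cong 1 0 (theta_even + theta_odd)" by (simp add: exponents_cong_def)
  then show ?thesis
    unfolding theta_even_dilation[symmetric]
    using exponents_cong_dilate[of 1 0 "theta_even + theta_odd" 4]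
    by (simp flip: theta_even_dilation)
qed

text \<open>
  Apply the splitting of \<open>\<phi>\<close> once more inside \<open>E(q) = \<phi>(q\<^sup>4)\<close>: this gives \<open>x = E(q\<^sup>4)\<close> and
  \<open>y = h(q\<^sup>4)\<close>, where \<open>h\<close> is the series of odd squares.
\<close>

lemma theta_even_mod_8:
  obtains x y where "theta_even = x + 2 * y" "exponents_cong 8 0 x" "exponents_cong 8 4 y"
proof
  show "theta_even = (theta_even oo fps_X ^ 4) + 2 * (odd_squares oo fps_X ^ 4)"
    by (subst theta_even_dilation) (simp add: theta_odd_eq fps_compose_add_distrib fps_compose_mult_distrib)
  show "exponents_cong 8 0 (theta_even oo fps_X ^ 4)"
    using exponents_cong_modulus[OF exponents_cong_dilate[OF exponents_cong_theta_even, of 4], of 8] by simp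
  show "exponents_cong 8 4 (odd_squares oo fps_X ^ 4)"
    using exponents_cong_modulus[OF exponents_cong_dilate[OF exponents_cong_odd_squares, of 4], of 8] by simp
qed

lemma dilate_dilate: "(f oo fps_X ^ a) oo fps_X ^ b = f oo fps_X ^ (a * b)"
  if "a > 0" "b > 0" for f :: "int fps"
proof -
  have "(f oo fps_X ^ a) oo fps_X ^ b = f oo (fps_X ^ a oo fps_X ^ b)"
    using that by (intro fps_compose_assoc[symmetric]) auto
  also have "fps_X ^ a oo fps_X ^ b = (fps_X ^ (a * b) :: int fps)"
    using that by (simp add: fps_compose_power[symmetric] power_mult[symmetric] mult.commute)
  finally show ?thesis .
qed

lemma theta_two_squares_plus: "theta_even\<^sup>2 + theta_odd\<^sup>2 = ((theta_even + theta_odd) oo fps_X ^ 2)\<^sup>2"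
  using theta_two_squares[of 1] by simp

lemma theta_two_squares_minus: "theta_even\<^sup>2 - theta_odd\<^sup>2 = ((theta_even - theta_odd) oo fps_X ^ 2)\<^sup>2"
  using theta_two_squares[of "-1"] by (simp flip: fps_const_neg)

text \<open>
  With \<open>D = \<phi>(-q\<^sup>4)\<close>, the two-square identities give \<open>(E\<^sup>2 - H\<^sup>2) (E\<^sup>2 + H\<^sup>2) = D\<^sup>4\<close> and \<open>E D = \<phi>(-q\<^sup>8)\<^sup>2\<close>,
  where \<open>H\<close> is the odd part of \<open>\<phi>\<close>. By Gauss's identity in \<open>q\<^sup>8\<close>, the series \<open>v = P(q\<^sup>8)\<^sup>8\<close> is an
  inverse of \<open>(E D)\<^sup>4\<close>. The last claim says that such a series \<open>s = P w / (E\<^sup>2 - H\<^sup>2)\<close>, which is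
  \<open>(E + H) w / (E\<^sup>2 - H\<^sup>2)\<^sup>2\<close>, can be cleared in the same way.
\<close>

lemma overpartition_fps_dissection:
  obtains v where "exponents_cong 8 0 v"
    "overpartition_fps {0<..} = (theta_even + theta_odd) * (theta_even\<^sup>2 + theta_odd\<^sup>2) * theta_even ^ 4 * v"
    "\<forall>s w. s * (theta_even\<^sup>2 - theta_odd\<^sup>2) = overpartition_fps {0<..} * w \<longrightarrow>
       s = (theta_even + theta_odd) * w * (theta_even\<^sup>2 + theta_odd\<^sup>2)\<^sup>2 * theta_even ^ 8 * v\<^sup>2"
proof -
  define E H where "E = theta_even" and "H = theta_odd"
  define D where "D = (E - H) oo fps_X ^ 4"
  define u where "u = overpartition_fps {0<..} oo fps_X ^ 8"
  have E4: "E = (E + H) oo fps_X ^ 4" unfolding E_def H_def by (rule theta_even_dilation)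
  have minus: "E\<^sup>2 - H\<^sup>2 = ((E - H) oo fps_X ^ 2)\<^sup>2" and plus: "E\<^sup>2 + H\<^sup>2 = ((E + H) oo fps_X ^ 2)\<^sup>2"
    using theta_two_squares_minus theta_two_squares_plus by (simp_all add: E_def H_def)
  have D4: "(E\<^sup>2 - H\<^sup>2) * (E\<^sup>2 + H\<^sup>2) = D ^ 4"
  proof -
    have "(E\<^sup>2 - H\<^sup>2) * (E\<^sup>2 + H\<^sup>2) = (((E - H) * (E + H)) oo fps_X ^ 2)\<^sup>2"
      unfolding minus plus by (simp add: fps_compose_mult_distrib power_mult_distrib)
    also have "(E - H) * (E + H) = ((E - H) oo fps_X ^ 2)\<^sup>2"
      unfolding minus[symmetric] by (simp add: power2_eq_square algebra_simps)
    also have "((E - H) oo fps_X ^ 2)\<^sup>2 oo fps_X ^ 2 = D\<^sup>2"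
      by (simp add: fps_compose_power[symmetric] dilate_dilate D_def)
    finally show ?thesis by (simp flip: power_mult)
  qed
  have ED: "E * D = ((E - H) oo fps_X ^ 8)\<^sup>2"
  proof -
    have "E * D = ((E + H) * (E - H)) oo fps_X ^ 4"
      by (subst E4) (simp add: D_def fps_compose_mult_distrib)
    also have "(E + H) * (E - H) = ((E - H) oo fps_X ^ 2)\<^sup>2"
      unfolding minus[symmetric] by (simp add: power2_eq_square algebra_simps)
    also have "((E - H) oo fps_X ^ 2)\<^sup>2 oo fps_X ^ 4 = ((E - H) oo fps_X ^ 8)\<^sup>2"
      by (simp add: fps_compose_power[symmetric] dilate_dilate)
    finally show ?thesis .
  qed
  have G: "overpartition_fps {0<..} * (E - H) = 1" unfolding E_def H_def by (rule Gauss_overpartition_identity)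
  have "u * ((E - H) oo fps_X ^ 8) = (overpartition_fps {0<..} * (E - H)) oo fps_X ^ 8"
    by (simp add: u_def fps_compose_mult_distrib)
  then have u: "u * ((E - H) oo fps_X ^ 8) = 1" by (simp add: G)
  have "(E * D) ^ 4 * u ^ 8 = (u * ((E - H) oo fps_X ^ 8)) ^ 8"
    unfolding ED by (simp add: power_mult_distrib mult.commute flip: power_mult)
  then have one: "E ^ 4 * D ^ 4 * u ^ 8 = 1" unfolding u by (simp add: power_mult_distrib)
  show ?thesis
  proof (rule that[of "u ^ 8"])
    have "exponents_cong 1 0 (overpartition_fps {0<..})" by (simp add: exponents_cong_def)
    from exponents_cong_dilate[OF this, of 8] show "exponents_cong 8 0 (u ^ 8)"
      unfolding u_def by (intro exponents_cong_power) simp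
    have P: "overpartition_fps {0<..} * (E\<^sup>2 - H\<^sup>2) = E + H"
    proof -
      have "overpartition_fps {0<..} * (E\<^sup>2 - H\<^sup>2) = (overpartition_fps {0<..} * (E - H)) * (E + H)"
        by (simp add: power2_eq_square algebra_simps)
      then show ?thesis unfolding G by simp
    qed
    have "overpartition_fps {0<..} = overpartition_fps {0<..} * (E ^ 4 * D ^ 4 * u ^ 8)" unfolding one by simp
    also have "\<dots> = (overpartition_fps {0<..} * (E\<^sup>2 - H\<^sup>2)) * (E\<^sup>2 + H\<^sup>2) * E ^ 4 * u ^ 8"
      unfolding D4[symmetric] by (simp only: mult_ac)
    finally show "overpartition_fps {0<..} = (theta_even + theta_odd) * (theta_even\<^sup>2 + theta_odd\<^sup>2) * theta_even ^ 4 * u ^ 8"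
      unfolding P by (simp only: E_def H_def)
    show "\<forall>s w. s * (theta_even\<^sup>2 - theta_odd\<^sup>2) = overpartition_fps {0<..} * w \<longrightarrow>
       s = (theta_even + theta_odd) * w * (theta_even\<^sup>2 + theta_odd\<^sup>2)\<^sup>2 * theta_even ^ 8 * (u ^ 8)\<^sup>2"
    proof (intro allI impI)
      fix s w assume "s * (theta_even\<^sup>2 - theta_odd\<^sup>2) = overpartition_fps {0<..} * w"
      then have S: "s * (E\<^sup>2 - H\<^sup>2) = overpartition_fps {0<..} * w" by (simp only: E_def H_def)
      have "s = s * (E ^ 4 * D ^ 4 * u ^ 8)\<^sup>2" unfolding one by simp
      also have "\<dots> = (s * (E\<^sup>2 - H\<^sup>2)) * (E\<^sup>2 - H\<^sup>2) * (E\<^sup>2 + H\<^sup>2)\<^sup>2 * E ^ 8 * (u ^ 8)\<^sup>2"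
        unfolding D4[symmetric] by (simp add: power_mult_distrib power2_eq_square[of "E\<^sup>2 - H\<^sup>2"] mult_ac flip: power_mult)
      also have "\<dots> = (overpartition_fps {0<..} * (E\<^sup>2 - H\<^sup>2)) * w * (E\<^sup>2 + H\<^sup>2)\<^sup>2 * E ^ 8 * (u ^ 8)\<^sup>2"
        unfolding S by (simp only: mult_ac)
      finally show "s = (theta_even + theta_odd) * w * (theta_even\<^sup>2 + theta_odd\<^sup>2)\<^sup>2 * theta_even ^ 8 * (u ^ 8)\<^sup>2"
        unfolding P by (simp only: E_def H_def)
    qed
  qed
qed

section \<open>Sums of odd and even parts\<close>

definition part_sum_fps :: "(nat \<Rightarrow> bool) \<Rightarrow> int fps" where
  "part_sum_fps Q = Abs_fps (\<lambda>n. int (\<Sum>(P, L)\<in>overpartitions n. \<Sum>k\<in>#filter_mset Q P. k))"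

text \<open>
  The sum of \<open>2 k q\<^sup>k / (1 - q\<^sup>2\<^sup>k)\<close> over all \<open>k\<close> satisfying \<open>Q\<close>; without restriction on \<open>k\<close> it is the
  logarithmic derivative \<open>q P' / P\<close>.
\<close>

definition divisor_fps :: "(nat \<Rightarrow> bool) \<Rightarrow> int fps" where
  "divisor_fps Q = Abs_fps (\<lambda>m. \<Sum>k | k \<in> {1..m} \<and> Q k \<and> k dvd m \<and> odd (m div k). 2 * int k)"

lemma sum_mset_eq_sum_count:
  fixes M :: "nat multiset"
  assumes "finite A" "set_mset M \<subseteq> A"
  shows "sum_mset M = (\<Sum>k\<in>A. k * count M k)"
  using assms(2)
proof (induction M)
  case empty
  show ?case by simp
next
  case (add x M)
  have "(\<Sum>k\<in>A. k * count (add_mset x M) k) = (\<Sum>k\<in>A. k * count M k + (if x = k then k else 0))"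
    by (intro sum.cong) auto
  also have "\<dots> = sum_mset M + x"
    using add assms(1) by (simp add: sum.distrib)
  finally show ?case by simp
qed

lemma part_sum_fps_eq: "part_sum_fps Q = overpartition_fps {0<..} * divisor_fps Q"
proof (rule fps_ext)
  fix n
  let ?D = "\<lambda>k. Abs_fps (\<lambda>j. if odd j then 2 else 0) oo fps_X ^ k :: int fps"
  let ?K = "{k \<in> {1..n}. Q k}"
  have part_sum: "(\<Sum>k\<in>#filter_mset Q P. k) = (\<Sum>k\<in>?K. k * count P k)" if "P \<in> partitions n" for P
  proof -
    have "k \<in> {1..n}" if "k \<in># P" for k
    proof -
      have "k \<le> sum_mset P" using \<open>k \<in># P\<close> by (metis sum_mset.remove le_add1)
      then show ?thesis using \<open>P \<in> partitions n\<close> \<open>k \<in># P\<close> by (auto simp: partitions_def Suc_le_eq)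
    qed
    then have "sum_mset (filter_mset Q P) = (\<Sum>k\<in>?K. k * count (filter_mset Q P) k)"
      by (intro sum_mset_eq_sum_count) auto
    also have "\<dots> = (\<Sum>k\<in>?K. k * count P k)"
      by (intro sum.cong) auto
    finally show ?thesis by simp
  qed
  have "part_sum_fps Q $ n = (\<Sum>x\<in>overpartitions n. \<Sum>k\<in>?K. int k * int (count (fst x) k))"
    unfolding part_sum_fps_def fps_nth_Abs_fps of_nat_sum
    by (intro sum.cong) (auto simp: overpartitions_def part_sum[simplified])
  also have "\<dots> = (\<Sum>k\<in>?K. int k * (\<Sum>x\<in>overpartitions n. int (count (fst x) k)))"
    by (subst sum.swap) (simp only: sum_distrib_left)
  also have "\<dots> = (\<Sum>k\<in>?K. int k * (overpartition_fps {0<..} * ?D k) $ n)"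
    by (intro sum.cong) (auto simp: part_count_fps[symmetric] case_prod_unfold)
  also have "\<dots> = (overpartition_fps {0<..} * (\<Sum>k\<in>?K. fps_const (int k) * ?D k)) $ n"
    unfolding sum_distrib_left fps_sum_nth by (intro sum.cong) (auto simp: mult.left_commute)
  also have "\<dots> = (overpartition_fps {0<..} * divisor_fps Q) $ n"
  proof -
    have "(\<Sum>k\<in>?K. fps_const (int k) * ?D k) $ m = divisor_fps Q $ m" if "m \<le> n" for m
    proof -
      have "(\<Sum>k\<in>?K. fps_const (int k) * ?D k) $ m = (\<Sum>k\<in>?K. if k dvd m \<and> odd (m div k) then 2 * int k else 0)"
        unfolding fps_sum_nth by (intro sum.cong) (auto simp: fps_nth_compose_X_power)
      also have "\<dots> = divisor_fps Q $ m"
        unfolding divisor_fps_def fps_nth_Abs_fps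
      proof (intro sum.mono_neutral_cong_right ballI)
        fix k assume "k \<in> ?K - {k \<in> {1..m}. Q k \<and> k dvd m \<and> odd (m div k)}"
        then have "\<not> (k dvd m \<and> odd (m div k))"
          by (cases "m = 0") (auto dest: dvd_imp_le)
        then show "(if k dvd m \<and> odd (m div k) then 2 * int k else 0) = 0" by (simp only: if_False)
      qed (use that in auto)
      finally show ?thesis .
    qed
    then show ?thesis unfolding fps_mult_nth by (intro sum.cong) auto
  qed
  finally show "part_sum_fps Q $ n = (overpartition_fps {0<..} * divisor_fps Q) $ n" .
qed

lemma exponents_cong_divisor_fps_odd: "exponents_cong 2 1 (divisor_fps odd)"
  unfolding exponents_cong_def
proof (intro allI impI)
  fix m assume "divisor_fps odd $ m \<noteq> 0"
  then obtain k where "odd k" "k dvd m" "odd (m div k)"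
    unfolding divisor_fps_def fps_nth_Abs_fps by (elim sum.not_neutral_contains_not_neutral) auto
  then have "odd (k * (m div k))" by (simp only: even_mult_iff) simp
  then have "odd m" using \<open>k dvd m\<close> by simp
  then show "[m = 1] (mod 2)" by (simp add: cong_def odd_iff_mod_2_eq_one)
qed

lemma exponents_cong_divisor_fps_even: "exponents_cong 2 0 (divisor_fps even)"
  unfolding exponents_cong_def
proof (intro allI impI)
  fix m assume "divisor_fps even $ m \<noteq> 0"
  then obtain k where "even k" "k dvd m"
    unfolding divisor_fps_def fps_nth_Abs_fps by (elim sum.not_neutral_contains_not_neutral) auto
  then have "even m" by (rule dvd_trans)
  then show "[m = 0] (mod 2)" by (simp add: cong_def)
qed

lemma part_sum_fps_add: "part_sum_fps odd + part_sum_fps even = fps_X * fps_deriv (overpartition_fps {0<..})"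
proof (rule fps_ext)
  fix n
  have sum: "(\<Sum>k\<in>#filter_mset odd P. k) + (\<Sum>k\<in>#filter_mset even P. k) = sum_mset P" for P :: "nat multiset"
    by (induction P) auto
  have "(part_sum_fps odd + part_sum_fps even) $ n =
      int (\<Sum>x\<in>overpartitions n. (\<Sum>k\<in>#filter_mset odd (fst x). k) + (\<Sum>k\<in>#filter_mset even (fst x). k))"
    unfolding part_sum_fps_def by (simp add: case_prod_unfold sum.distrib)
  also have "\<dots> = int (\<Sum>x\<in>overpartitions n. n)"
    unfolding sum by (intro arg_cong[of _ _ int] sum.cong) (auto simp: overpartitions_def partitions_def)
  also have "\<dots> = (fps_X * fps_deriv (overpartition_fps {0<..})) $ n"
    unfolding q_derivative_nth by (simp add: overpartition_fps_def overpartitions_eq_overpartitions_in)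
  finally show "(part_sum_fps odd + part_sum_fps even) $ n = (fps_X * fps_deriv (overpartition_fps {0<..})) $ n" .
qed

lemma exponents_cong_2_disjoint:
  assumes "exponents_cong 2 0 f" "exponents_cong 2 1 g" "f = g"
  shows "f = 0"
proof (rule fps_ext)
  fix n :: nat
  have "\<not> [n = 0] (mod 2) \<or> \<not> [n = 1] (mod 2)" by (auto simp: cong_def)
  then have "f $ n = 0"
    using exponents_congD[OF assms(1)] exponents_congD[OF assms(2)] assms(3) by metis
  then show "f $ n = 0 $ n" by simp
qed

text \<open>
  Let \<open>a\<close> and \<open>b\<close> be the odd and even parts of \<open>q P' / P\<close>. Differentiating \<open>P (E - H) = 1\<close> gives
  \<open>q E' - q H' = (a + b) (H - E)\<close>. Separating parities yields \<open>q E' = a H - b E\<close> and \<open>q H' = a E - b H\<close>, and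
  eliminating \<open>b\<close> leaves \<open>E \<cdot> q H' - H \<cdot> q E' = a (E\<^sup>2 - H\<^sup>2)\<close>.
\<close>

lemma odd_part_sum_Wronskian:
  "part_sum_fps odd * (theta_even\<^sup>2 - theta_odd\<^sup>2) =
     overpartition_fps {0<..} * (theta_even * (fps_X * fps_deriv theta_odd) - theta_odd * (fps_X * fps_deriv theta_even))"
proof -
  define E H p where "E = theta_even" and "H = theta_odd" and "p = overpartition_fps {0<..}"
  define a b where "a = divisor_fps odd" and "b = divisor_fps even"
  define E' H' where "E' = fps_X * fps_deriv E" and "H' = fps_X * fps_deriv H"
  have G: "p * (E - H) = 1" unfolding p_def E_def H_def by (rule Gauss_overpartition_identity)
  have dp: "fps_X * fps_deriv p = p * (a + b)"
    unfolding p_def part_sum_fps_add[symmetric] part_sum_fps_eq a_def b_def by (simp only: distrib_left)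
  have "fps_X * fps_deriv (p * (E - H)) = 0" unfolding G by simp
  then have "p * (E' - H') + (fps_X * fps_deriv p) * (E - H) = 0"
    by (simp add: E'_def H'_def algebra_simps)
  then have "p * (E' - H' + (a + b) * (E - H)) = 0"
    unfolding dp by (simp add: algebra_simps)
  moreover have "p \<noteq> 0" using G by auto
  ultimately have "E' - H' + (a + b) * (E - H) = 0"
    by (blast dest: mult_eq_0_iff[THEN iffD1])
  then have *: "E' + b * E - a * H = H' + b * H - a * E"
    by (simp add: algebra_simps)
  have E: "exponents_cong 2 0 E" unfolding E_def
    by (rule exponents_cong_modulus[OF exponents_cong_theta_even]) simp
  have H: "exponents_cong 2 1 H" unfolding H_def theta_odd_eq
    using exponents_cong_mult[OF exponents_cong_numeral exponents_cong_modulus[OF exponents_cong_odd_squares, of 2], of _]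
    by simp
  have a: "exponents_cong 2 1 a" and b: "exponents_cong 2 0 b"
    unfolding a_def b_def by (rule exponents_cong_divisor_fps_odd exponents_cong_divisor_fps_even)+
  have E': "exponents_cong 2 0 E'" and H': "exponents_cong 2 1 H'"
    unfolding E'_def H'_def using E H by (auto intro: exponents_cong_q_derivative)
  have "exponents_cong 2 0 (a * H)"
    using exponents_cong_residue[OF exponents_cong_mult[OF a H], of 0] by (simp add: cong_def)
  then have "exponents_cong 2 0 (E' + b * E - a * H)"
    using exponents_cong_mult[OF b E] E' by (intro exponents_cong_add exponents_cong_diff) auto
  moreover have "exponents_cong 2 1 (H' + b * H - a * E)"
    using exponents_cong_mult[OF b H] exponents_cong_mult[OF a E] H'
    by (intro exponents_cong_add exponents_cong_diff) auto
  \<comment> \<open>an even series that equals an odd one vanishes, so both parities vanish\<close>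
  ultimately have 0: "E' + b * E - a * H = 0"
    by (rule exponents_cong_2_disjoint) (use * in simp)
  then have e: "E' = a * H - b * E" by (simp add: algebra_simps)
  have "H' + b * H - a * E = 0" using 0 unfolding * .
  then have h: "H' = a * E - b * H" by (simp add: algebra_simps)
  have "part_sum_fps odd * (E\<^sup>2 - H\<^sup>2) = p * (E * H' - H * E')"
    unfolding e h part_sum_fps_eq p_def[symmetric] a_def[symmetric]
    by (simp add: algebra_simps power2_eq_square)
  then show ?thesis unfolding E_def H_def p_def E'_def H'_def .
qed

section \<open>Extracting the residue classes 3 modulo 4 and 7 modulo 8\<close>

text \<open>
  In the expansions of both dissections only the terms of total degree 3 in \<open>h\<close> and \<open>q h'\<close> have
  exponents congruent to 3 modulo 4; degree 7 does not occur.
\<close>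

lemma overpartition_residue_3:
  obtains v where "exponents_cong 8 0 v"
    "\<forall>n. [n = 3] (mod 4) \<longrightarrow> overpartition_fps {0<..} $ n = 8 * (theta_even ^ 4 * odd_squares ^ 3 * v) $ n"
    "\<forall>n. [n = 3] (mod 4) \<longrightarrow> part_sum_fps odd $ n =
       16 * (theta_even ^ 12 * odd_squares ^ 2 * (fps_X * fps_deriv odd_squares) * v\<^sup>2) $ n -
       16 * (theta_even ^ 11 * odd_squares ^ 3 * (fps_X * fps_deriv theta_even) * v\<^sup>2) $ n"
proof -
  define E h where "E = theta_even" and "h = odd_squares"
  define E' h' where "E' = fps_X * fps_deriv E" and "h' = fps_X * fps_deriv h"
  define w where "w = E * h' - h * E'"
  obtain v where v: "exponents_cong 8 0 v"
    and p0: "overpartition_fps {0<..} = (theta_even + theta_odd) * (theta_even\<^sup>2 + theta_odd\<^sup>2) * theta_even ^ 4 * v"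
    and s0: "\<forall>s w. s * (theta_even\<^sup>2 - theta_odd\<^sup>2) = overpartition_fps {0<..} * w \<longrightarrow>
       s = (theta_even + theta_odd) * w * (theta_even\<^sup>2 + theta_odd\<^sup>2)\<^sup>2 * theta_even ^ 8 * v\<^sup>2"
    by (rule overpartition_fps_dissection)
  have p: "overpartition_fps {0<..} = (E + 2 * h) * (E\<^sup>2 + (2 * h)\<^sup>2) * E ^ 4 * v"
    using p0 unfolding theta_odd_eq E_def h_def .
  note s = s0[unfolded theta_odd_eq, folded E_def h_def, rule_format]
  have "fps_X * fps_deriv (2 * h) = 2 * h'" by (simp add: h'_def mult.left_commute)
  then have "part_sum_fps odd * (E\<^sup>2 - (2 * h)\<^sup>2) = overpartition_fps {0<..} * (2 * w)"
    using odd_part_sum_Wronskian unfolding theta_odd_eq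
    by (simp add: w_def E_def[symmetric] h_def[symmetric] E'_def[symmetric] algebra_simps)
  from s[OF this] have q: "part_sum_fps odd = (E + 2 * h) * (2 * w) * (E\<^sup>2 + (2 * h)\<^sup>2)\<^sup>2 * E ^ 8 * v\<^sup>2" .
  have E4: "exponents_cong 4 0 E" and v4: "exponents_cong 4 0 v" and h4: "exponents_cong 4 1 h"
    using exponents_cong_theta_even exponents_cong_modulus[OF v, of 4]
      exponents_cong_modulus[OF exponents_cong_odd_squares, of 4] by (simp_all add: E_def h_def)
  have E'4: "exponents_cong 4 0 E'" and h'4: "exponents_cong 4 1 h'"
    unfolding E'_def h'_def by (rule exponents_cong_q_derivative[OF E4], rule exponents_cong_q_derivative[OF h4])
  have w4: "exponents_cong 4 1 w"
    unfolding w_def using exponents_cong_mult[OF E4 h'4] exponents_cong_mult[OF h4 E'4]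
    by (intro exponents_cong_diff) simp_all
  have h_power: "exponents_cong 4 i (h ^ i)" for i
  proof (induction i)
    case 0
    show ?case using exponents_cong_const[of 4 1] by simp
  next
    case (Suc i)
    then show ?case using exponents_cong_mult[OF h4 Suc] by simp
  qed
  have p_term: "exponents_cong 4 i (E ^ a * h ^ i * v)" for a i
    using exponents_cong_mult[OF exponents_cong_mult[OF exponents_cong_power[OF E4, of a] h_power[of i]] v4] by simp
  have q_term: "exponents_cong 4 (Suc i) (E ^ a * h ^ i * w * v\<^sup>2)" for a i
    using exponents_cong_mult[OF exponents_cong_mult[OF exponents_cong_mult[OF
        exponents_cong_power[OF E4, of a] h_power[of i]] w4] exponents_cong_power[OF v4, of 2]] by simp
  have p_expand: "overpartition_fps {0<..} = E ^ 7 * h ^ 0 * v + 2 * (E ^ 6 * h ^ 1 * v) +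
      4 * (E ^ 5 * h ^ 2 * v) + 8 * (E ^ 4 * h ^ 3 * v)"
    unfolding p by algebra
  have q_expand: "part_sum_fps odd = 2 * (E ^ 13 * h ^ 0 * w * v\<^sup>2) + 4 * (E ^ 12 * h ^ 1 * w * v\<^sup>2) +
      16 * (E ^ 11 * h ^ 2 * w * v\<^sup>2) + 32 * (E ^ 10 * h ^ 3 * w * v\<^sup>2) +
      32 * (E ^ 9 * h ^ 4 * w * v\<^sup>2) + 64 * (E ^ 8 * h ^ 5 * w * v\<^sup>2)"
    unfolding q by algebra
  have w_expand: "E ^ 11 * h ^ 2 * w * v\<^sup>2 = E ^ 12 * h ^ 2 * h' * v\<^sup>2 - E ^ 11 * h ^ 3 * E' * v\<^sup>2"
    unfolding w_def by algebra
  have vanish: "f $ n = 0" if "exponents_cong 4 r f" "[n = 3] (mod 4)" "r mod 4 \<noteq> 3" for f :: "int fps" and n r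
  proof (rule exponents_congD[OF that(1)])
    show "\<not> [n = r] (mod 4)" using that(2,3) by (simp add: cong_def)
  qed
  show ?thesis
  proof (rule that[OF v]; intro allI impI)
    fix n :: nat assume n: "[n = 3] (mod 4)"
    have "(E ^ 7 * h ^ 0 * v) $ n = 0" "(E ^ 6 * h ^ 1 * v) $ n = 0" "(E ^ 5 * h ^ 2 * v) $ n = 0"
      by (rule vanish[OF p_term n]; simp)+
    then show "overpartition_fps {0<..} $ n = 8 * (theta_even ^ 4 * odd_squares ^ 3 * v) $ n"
      unfolding E_def[symmetric] h_def[symmetric] p_expand
      by (simp only: fps_add_nth numeral_mult_fps_nth mult_zero_right add_0)
  next
    fix n :: nat assume n: "[n = 3] (mod 4)"
    have "(E ^ 13 * h ^ 0 * w * v\<^sup>2) $ n = 0" "(E ^ 12 * h ^ 1 * w * v\<^sup>2) $ n = 0"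
      "(E ^ 10 * h ^ 3 * w * v\<^sup>2) $ n = 0" "(E ^ 9 * h ^ 4 * w * v\<^sup>2) $ n = 0" "(E ^ 8 * h ^ 5 * w * v\<^sup>2) $ n = 0"
      by (rule vanish[OF q_term n]; simp)+
    then have "part_sum_fps odd $ n = 16 * (E ^ 11 * h ^ 2 * w * v\<^sup>2) $ n"
      unfolding q_expand by (simp only: fps_add_nth numeral_mult_fps_nth mult_zero_right add_0 add_0_right)
    then show "part_sum_fps odd $ n =
        16 * (theta_even ^ 12 * odd_squares ^ 2 * (fps_X * fps_deriv odd_squares) * v\<^sup>2) $ n -
        16 * (theta_even ^ 11 * odd_squares ^ 3 * (fps_X * fps_deriv theta_even) * v\<^sup>2) $ n"
      unfolding w_expand fps_sub_nth
      unfolding E_def[symmetric] h_def[symmetric] h'_def[symmetric] E'_def[symmetric]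
      by (simp only: right_diff_distrib)
  qed
qed

lemma q_derivative_theta_even: "\<exists>f. fps_X * fps_deriv theta_even = 4 * f"
proof
  show "fps_X * fps_deriv theta_even = 4 * Abs_fps (\<lambda>n. int (n div 4) * theta_even $ n)"
  proof (rule fps_ext)
    fix n
    show "(fps_X * fps_deriv theta_even) $ n = (4 * Abs_fps (\<lambda>n. int (n div 4) * theta_even $ n)) $ n"
    proof (cases "4 dvd n")
      case True
      then obtain m where "n = 4 * m" by blast
      then show ?thesis unfolding q_derivative_nth numeral_mult_fps_nth by simp
    next
      case False
      then have "theta_even $ n = 0"
        by (intro exponents_congD[OF exponents_cong_theta_even]) (simp add: cong_0_iff)
      then show ?thesis unfolding q_derivative_nth numeral_mult_fps_nth by simp
    qed
  qed
qed

text \<open>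
  Multiplying by \<open>a\<close> does not move residue classes modulo 8, so \<open>a * g\<close> stays in the class of 3.
\<close>

lemma coefficient_dvd_of_residue_7:
  assumes "exponents_cong 8 3 g" "f = a * g + numeral c * r" "[n = 7] (mod 8)" "exponents_cong 8 0 a"
  shows "numeral c dvd (f :: int fps) $ n"
proof -
  have "exponents_cong 8 3 (a * g)" using exponents_cong_mult[OF assms(4,1)] by simp
  then have "(a * g) $ n = 0"
    by (rule exponents_congD) (use assms(3) in \<open>simp add: cong_def\<close>)
  then show ?thesis unfolding assms(2) by (simp only: fps_add_nth numeral_mult_fps_nth add_0 dvd_triv_left)
qed

text \<open>
  Modulo 4 the powers of \<open>E\<^sup>2 = (x\<^sup>2 + 4 y\<^sup>2) + 4 x y\<close> agree with powers of \<open>x\<^sup>2 + 4 y\<^sup>2\<close>, whose exponents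
  are divisible by 8; for the square of \<open>E\<^sup>2\<close> the agreement is modulo 8. Multiplied by a cubic term
  in \<open>h\<close> and \<open>q h'\<close>, these lie in the class of 3 modulo 8 and miss the class of 7.
\<close>

lemma overpartition_congruences:
  assumes "[n = 3] (mod 4)"
  shows "8 dvd overpartition_fps {0<..} $ n" "8 dvd part_sum_fps odd $ n"
    "[n = 7] (mod 8) \<Longrightarrow> 64 dvd overpartition_fps {0<..} $ n"
    "[n = 7] (mod 8) \<Longrightarrow> 64 dvd part_sum_fps odd $ n"
proof -
  define E h where "E = theta_even" and "h = odd_squares"
  define h' where "h' = fps_X * fps_deriv h"
  obtain e where e: "fps_X * fps_deriv theta_even = 4 * e" using q_derivative_theta_even by blast
  obtain v where v: "exponents_cong 8 0 v"
    and p0: "\<forall>n. [n = 3] (mod 4) \<longrightarrow> overpartition_fps {0<..} $ n = 8 * (theta_even ^ 4 * odd_squares ^ 3 * v) $ n"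
    and q0: "\<forall>n. [n = 3] (mod 4) \<longrightarrow> part_sum_fps odd $ n =
       16 * (theta_even ^ 12 * odd_squares ^ 2 * (fps_X * fps_deriv odd_squares) * v\<^sup>2) $ n -
       16 * (theta_even ^ 11 * odd_squares ^ 3 * (fps_X * fps_deriv theta_even) * v\<^sup>2) $ n"
    by (rule overpartition_residue_3)
  have p: "overpartition_fps {0<..} $ n = 8 * (E ^ 4 * h ^ 3 * v) $ n"
    and q: "part_sum_fps odd $ n = 16 * (E ^ 12 * h ^ 2 * h' * v\<^sup>2) $ n - 16 * (E ^ 11 * h ^ 3 * (4 * e) * v\<^sup>2) $ n"
    using p0 q0 assms unfolding E_def h_def h'_def e by simp_all
  have e4: "(E ^ 11 * h ^ 3 * (4 * e) * v\<^sup>2) $ n = 4 * (E ^ 11 * h ^ 3 * e * v\<^sup>2) $ n"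
    unfolding numeral_mult_fps_nth[symmetric] by (simp only: mult_ac)
  have q': "part_sum_fps odd $ n = 16 * (E ^ 12 * h ^ 2 * h' * v\<^sup>2) $ n - 64 * (E ^ 11 * h ^ 3 * e * v\<^sup>2) $ n"
    unfolding q e4 by simp
  show "8 dvd overpartition_fps {0<..} $ n" unfolding p by simp
  show "8 dvd part_sum_fps odd $ n" unfolding q' by (intro dvd_diff dvd_mult2) simp_all
  obtain x y where E: "E = x + 2 * y" and x: "exponents_cong 8 0 x" and y: "exponents_cong 8 4 y"
    unfolding E_def by (rule theta_even_mod_8)
  have h: "exponents_cong 8 1 h" unfolding h_def by (rule exponents_cong_odd_squares)
  have h': "exponents_cong 8 1 h'" unfolding h'_def by (rule exponents_cong_q_derivative[OF h])
  have h2: "exponents_cong 8 2 (h\<^sup>2)"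
    using exponents_cong_mult[OF h h] by (simp add: power2_eq_square numeral_2_eq_2)
  define a where "a = x\<^sup>2 + 4 * y\<^sup>2"
  have y2: "exponents_cong 8 0 (y\<^sup>2)"
    using exponents_cong_residue[OF exponents_cong_mult[OF y y], of 0] by (simp add: power2_eq_square cong_def)
  have "exponents_cong 8 0 (4 * y\<^sup>2)"
    using exponents_cong_mult[OF exponents_cong_numeral y2] by simp
  then have a: "exponents_cong 8 0 a"
    unfolding a_def using exponents_cong_power[OF x, of 2] by (intro exponents_cong_add)
  have E2: "E\<^sup>2 = a + 4 * (x * y)" unfolding E a_def by algebra
  show "64 dvd overpartition_fps {0<..} $ n" if n: "[n = 7] (mod 8)"
  proof -
    have "E ^ 4 = (E\<^sup>2)\<^sup>2" by simp
    then have "E ^ 4 * h ^ 3 * v = a\<^sup>2 * (h\<^sup>2 * h * v) + 8 * ((a * x * y + 2 * (x * y)\<^sup>2) * h ^ 3 * v)"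
      unfolding E2 by algebra
    moreover have "exponents_cong 8 3 (h\<^sup>2 * h * v)"
      using exponents_cong_mult[OF exponents_cong_mult[OF h2 h] v] by simp
    ultimately have "8 dvd (E ^ 4 * h ^ 3 * v) $ n"
      using coefficient_dvd_of_residue_7[OF _ _ n exponents_cong_power[OF a]] by blast
    then show ?thesis unfolding p by (elim dvdE) simp
  qed
  show "64 dvd part_sum_fps odd $ n" if n: "[n = 7] (mod 8)"
  proof -
    have "E ^ 12 = (E\<^sup>2) ^ 6" by simp
    moreover obtain r where "(a + 4 * (x * y)) ^ 6 = a ^ 6 + 4 * r"
    proof -
      have "a + 4 * (x * y) - a dvd (a + 4 * (x * y)) ^ 6 - a ^ 6"
        by (metis dvd_triv_left power_diff_sumr2)
      then have "4 dvd (a + 4 * (x * y)) ^ 6 - a ^ 6"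
        by (metis add_diff_cancel_left' dvd_mult_left)
      then show ?thesis using that by (metis add.commute diff_eq_eq dvdE)
    qed
    ultimately have "E ^ 12 * h ^ 2 * h' * v\<^sup>2 = a ^ 6 * (h\<^sup>2 * h' * v\<^sup>2) + 4 * (r * h\<^sup>2 * h' * v\<^sup>2)"
      unfolding E2 by (simp add: algebra_simps)
    moreover have "exponents_cong 8 3 (h\<^sup>2 * h' * v\<^sup>2)"
      using exponents_cong_mult[OF exponents_cong_mult[OF h2 h'] exponents_cong_power[OF v]] by simp
    ultimately have "4 dvd (E ^ 12 * h ^ 2 * h' * v\<^sup>2) $ n"
      using coefficient_dvd_of_residue_7[OF _ _ n exponents_cong_power[OF a]] by blast
    then show ?thesis unfolding q' by (elim dvdE) simp
  qed
qed

theorem corollary9: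
  fixes n :: nat
  shows "([odd_part_sum (4 * n + 3) = even_part_sum (4 * n + 3)] (mod 8) \<and>
          [even_part_sum (4 * n + 3) = 0] (mod 8)) \<and>
         ([odd_part_sum (8 * n + 7) = even_part_sum (8 * n + 7)] (mod 64) \<and>
          [even_part_sum (8 * n + 7) = 0] (mod 64))"
proof -
  have cong: "[odd_part_sum m = even_part_sum m] (mod d) \<and> [even_part_sum m = 0] (mod d)"
    if "int d dvd overpartition_fps {0<..} $ m" "int d dvd part_sum_fps odd $ m" for d m
  proof -
    have "part_sum_fps odd $ m + part_sum_fps even $ m = int m * overpartition_fps {0<..} $ m"
      using arg_cong[OF part_sum_fps_add, of "\<lambda>f. f $ m"] unfolding q_derivative_nth by simp
    then have "part_sum_fps even $ m = int m * overpartition_fps {0<..} $ m - part_sum_fps odd $ m"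
      by linarith
    then have "int d dvd part_sum_fps even $ m"
      using that by simp
    then have "int d dvd int (odd_part_sum m)" "int d dvd int (even_part_sum m)"
      using that(2) by (simp_all add: part_sum_fps_def odd_part_sum_def even_part_sum_def)
    then have "d dvd odd_part_sum m" "d dvd even_part_sum m" by (simp_all only: int_dvd_int_iff)
    then show ?thesis by (simp add: cong_def)
  qed
  have "[4 * n + 3 = 3] (mod 4)" "[8 * n + 7 = 7] (mod 8)" by (simp_all add: cong_def)
  moreover have "[8 * n + 7 = 3] (mod 4)"
    using cong_dvd_modulus_nat[OF \<open>[8 * n + 7 = 7] (mod 8)\<close>, of 4] by (simp add: cong_def)
  ultimately show ?thesis
    using overpartition_congruences cong[of 8 "4 * n + 3"] cong[of 64 "8 * n + 7"] by simp
qed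

end
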